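(* Let $X=\{0,1\}$. Let $A$ be an automorphism of the binary rooted tree $X^*$ given by a finite initial Mealy automaton, of bounded activity and acting transitively on every level, and let $B$ be an invertible endomorphism of the binary rooted tree given by a finite initial Mealy automaton. Then the automaton $\mathcal L_{A,B}$ (defined in the context) is a Moore machine.
   Context: $X^*$ is the set of finite words over $X$, viewed as a rooted tree ($w$ adjacent to $wa$). An endomorphism is a map $g:X^*\to X^*$ preserving word length and adjacency; an automorphism is an invertible endomorphism; $\mathbf 1$ is the identity; $gh=g\circ h$. The section $g|_w$ is defined by $g(wv)=g(w)\,g|_w(v)$ for all words $v$. A finite initial Mealy automaton over $X$ has a finite state set $S$, initial state $q$, transition map $\pi:S\times X\to S$ and output map $\lambda:S\times X\to X$, and acts on words letter by letter starting at $q$. It is a Moore machine if $\lambda(s,x)=\lambda(s,y)$ for every state $s$ and all $x,y\in X$. $A$ has bounded activity if there is a constant $c$ such that for every $n$ the number of $w\in X^n$ with $A|_w\ne\mathbf 1$ is less than $c$. $A$ acts transitively on levels if for all $n$ and $w_1,w_2\in X^n$ some power $A^k$ maps $w_1$ to $w_2$ ($k$ is then unique mod $2^n$). For $w\in X^n$ let $d(w)\in\{0,\dots,2^n-1\}$ be the integer with $A^{d(w)}(w)=B(w)$. The automaton $\mathcal L_{A,B}$ has state set $S_{A,B}=\{(B|_w,A^{d(w)}|_w,A^{2^{|w|}}|_w):w\in X^*\}$, initial state $(B,\mathbf 1,A)$, transition function $\pi((\beta,\gamma,\delta),a)=(\beta|_a,\gamma',\delta^2|_a)$ with $\gamma'=\gamma|_a$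 if $\beta(a)=\gamma(a)$ and $\gamma'=(\gamma\delta)|_a$ otherwise, and output function $\lambda((\beta,\gamma,\delta),a)=0$ if $\beta(a)=\gamma(a)$ and $1$ otherwise. *)

theory Defs
  imports Main "HOL-Library.Z2"
begin

text \<open>
  Words over the alphabet \<open>'x\<close> are lists over \<open>'x\<close>, with the root \<open>[]\<close>; the children of \<open>w\<close>
  are the words \<open>w @ [a]\<close>. The binary alphabet is the type \<open>bit\<close>, whose only elements are
  \<open>0\<close> and \<open>1\<close>.
\<close>

definition tree_adjacent :: "'x list \<Rightarrow> 'x list \<Rightarrow> bool" where
  "tree_adjacent u v \<longleftrightarrow> (\<exists>a. v = u @ [a] \<or> u = v @ [a])"

definition tree_endomorphism :: "('x list \<Rightarrow> 'x list) \<Rightarrow> bool" where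
  "tree_endomorphism g \<longleftrightarrow>
     (\<forall>w. length (g w) = length w) \<and>
     (\<forall>u v. tree_adjacent u v \<longrightarrow> tree_adjacent (g u) (g v))"

definition tree_automorphism :: "('x list \<Rightarrow> 'x list) \<Rightarrow> bool" where
  "tree_automorphism g \<longleftrightarrow>
     tree_endomorphism g \<and> (\<exists>h. tree_endomorphism h \<and> g \<circ> h = id \<and> h \<circ> g = id)"

text \<open>
  For an endomorphism \<open>g\<close> the word \<open>g w\<close> is a prefix of \<open>g (w @ v)\<close>, and the section at \<open>w\<close>
  is read off by deleting it; \<open>tree_section_iff\<close> below is the usual defining property.
\<close>

definition tree_section :: "('x list \<Rightarrow> 'x list) \<Rightarrow> 'x list \<Rightarrow> 'x list \<Rightarrow> 'x list" where
  "tree_section g w v = drop (length w) (g (w @ v))"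

lemma tree_endomorphism_prefix:
  assumes "tree_endomorphism g"
  shows "take (length w) (g (w @ v)) = g w"
proof (induction v rule: rev_induct)
  case Nil
  then show ?case
    using assms by (simp add: tree_endomorphism_def)
next
  case (snoc a v)
  have len: "length (g u) = length u" for u
    using assms by (simp add: tree_endomorphism_def)
  have "tree_adjacent (w @ v) (w @ v @ [a])"
    by (simp add: tree_adjacent_def)
  then have "tree_adjacent (g (w @ v)) (g (w @ v @ [a]))"
    using assms unfolding tree_endomorphism_def by blast
  then obtain b where
    "g (w @ v @ [a]) = g (w @ v) @ [b] \<or> g (w @ v) = g (w @ v @ [a]) @ [b]"
    unfolding tree_adjacent_def by blast
  moreover have "g (w @ v) \<noteq> g (w @ v @ [a]) @ [b]"
  proof
    assume "g (w @ v) = g (w @ v @ [a]) @ [b]"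
    then have "length (g (w @ v)) = Suc (length (g (w @ v @ [a])))"
      by simp
    then show False
      by (simp add: len)
  qed
  ultimately have "g (w @ v @ [a]) = g (w @ v) @ [b]"
    by blast
  then show ?case
    using snoc by (simp add: len)
qed

lemma tree_section_iff:
  assumes "tree_endomorphism g"
  shows "(\<forall>v. g (w @ v) = g w @ h v) \<longleftrightarrow> h = tree_section g w"
proof
  have len: "length (g u) = length u" for u
    using assms by (simp add: tree_endomorphism_def)
  show "h = tree_section g w" if "\<forall>v. g (w @ v) = g w @ h v"
    using that by (simp add: fun_eq_iff tree_section_def len)
  show "\<forall>v. g (w @ v) = g w @ h v" if "h = tree_section g w"
    unfolding that tree_section_def
    using tree_endomorphism_prefix[OF assms] by (metis append_take_drop_id)
qed

type_synonym tree_map = "bit list \<Rightarrow> bit list"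

definition bounded_activity :: "tree_map \<Rightarrow> bool" where
  "bounded_activity g \<longleftrightarrow>
     (\<exists>c::nat. \<forall>n. card {w. length w = n \<and> tree_section g w \<noteq> id} < c)"

text \<open>
  Exponents may be taken nonnegative: an automorphism permutes each finite level, so its
  integer powers and its nonnegative powers have the same orbits there.
\<close>

definition level_transitive :: "tree_map \<Rightarrow> bool" where
  "level_transitive g \<longleftrightarrow>
     (\<forall>n w1 w2. length w1 = n \<and> length w2 = n \<longrightarrow> (\<exists>k::nat. (g ^^ k) w1 = w2))"

record ('s, 'x) mealy =
  states :: "'s set"
  initial :: 's
  transition :: "'s \<Rightarrow> 'x \<Rightarrow> 's"
  out_letter :: "'s \<Rightarrow> 'x \<Rightarrow> 'x"

text \<open>
  The functions \<open>transition M\<close> and \<open>out_letter M\<close> are total on \<open>'s\<close>; only their values on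
  \<open>states M\<close> are meaningful.
\<close>

definition finite_initial_mealy :: "('s, 'x) mealy \<Rightarrow> bool" where
  "finite_initial_mealy M \<longleftrightarrow>
     finite (states M) \<and> initial M \<in> states M \<and>
     (\<forall>s \<in> states M. \<forall>x. transition M s x \<in> states M)"

primrec mealy_run :: "('s, 'x) mealy \<Rightarrow> 's \<Rightarrow> 'x list \<Rightarrow> 'x list" where
  "mealy_run M s [] = []"
| "mealy_run M s (x # xs) = out_letter M s x # mealy_run M (transition M s x) xs"

definition mealy_action :: "('s, 'x) mealy \<Rightarrow> 'x list \<Rightarrow> 'x list" where
  "mealy_action M = mealy_run M (initial M)"

definition moore_machine :: "('s, 'x) mealy \<Rightarrow> bool" where
  "moore_machine M \<longleftrightarrow>
     finite_initial_mealy M \<and>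
     (\<forall>s \<in> states M. \<forall>x y. out_letter M s x = out_letter M s y)"

text \<open>
  For \<open>A\<close> level-transitive and \<open>B\<close> length-preserving, \<open>d\<close> exists and is unique, as \<open>A\<close> permutes
  the words of length \<open>n\<close> in a single cycle of length \<open>2 ^ n\<close>.
\<close>

definition disp :: "tree_map \<Rightarrow> tree_map \<Rightarrow> bit list \<Rightarrow> nat" where
  "disp A B w = (THE d. d < 2 ^ length w \<and> (A ^^ d) w = B w)"

text \<open>
  Products of tree maps are compositions, \<open>\<gamma>\<delta> = \<gamma> \<circ> \<delta>\<close>, and a letter \<open>a\<close> is the word \<open>[a]\<close>.
\<close>

definition L_automaton ::
  "tree_map \<Rightarrow> tree_map \<Rightarrow> (tree_map \<times> tree_map \<times> tree_map, bit) mealy" where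
  "L_automaton A B =
     \<lparr> states = {(tree_section B w,
                  tree_section (A ^^ disp A B w) w,
                  tree_section (A ^^ (2 ^ length w)) w) | w. True},
       initial = (B, id, A),
       transition = (\<lambda>(\<beta>, \<gamma>, \<delta>) a.
         (tree_section \<beta> [a],
          (if \<beta> [a] = \<gamma> [a] then tree_section \<gamma> [a] else tree_section (\<gamma> \<circ> \<delta>) [a]),
          tree_section (\<delta> ^^ 2) [a])),
       out_letter = (\<lambda>(\<beta>, \<gamma>, \<delta>) a. if \<beta> [a] = \<gamma> [a] then 0 else 1) \<rparr>"

end

theory Submission
  imports Defs
begin

text \<open>
  The words \<open>A\<^sup>i w\<close> with \<open>i < 2\<^sup>n\<close>, \<open>n = |w|\<close>, are pairwise distinct, so for \<open>k \<le> 2\<^sup>n\<close> the section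
  of \<open>A\<^sup>k\<close> at \<open>w\<close> is a product of sections of \<open>A\<close> at distinct words of length \<open>n\<close>. By bounded
  activity fewer than \<open>c\<close> of the factors are nontrivial, and they come from a finite set; hence
  there are finitely many such sections. The output does not depend on the letter because two
  permutations of a two-letter alphabet that agree at one letter are equal.
\<close>

section \<open>Counting binary words; maps with a single orbit\<close>

lemma card_words: "card {w :: bit list. length w = n} = 2 ^ n"
proof -
  have UNIV_bit: "(UNIV :: bit set) = {0, 1}"
    using bit_not_zero_iff by blast
  have "finite (UNIV :: bit set)" and "card (UNIV :: bit set) = 2"
    unfolding UNIV_bit by simp_all
  then show ?thesis
    using card_lists_length_eq[of "UNIV :: bit set" n] by simp
qed

lemma finite_words: "finite {w :: bit list. length w = n}"
  by (rule card_ge_0_finite) (simp add: card_words)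

lemma bit_neq_neq_eq:
  fixes a b c :: bit
  shows "a \<noteq> b \<Longrightarrow> b \<noteq> c \<Longrightarrow> a = c"
  by (metis bit_not_zero_iff)

text \<open>Since \<open>f x\<close> can be sent back to \<open>x\<close>, a positive return time
  exists. For the least one, \<open>p\<close>, the iterates below \<open>p\<close> are distinct, and
  reducing exponents mod \<open>p\<close> shows that they exhaust \<open>S\<close>; hence
  \<open>p = card S\<close>.\<close>

lemma single_orbit:
  assumes "\<And>y. y \<in> S \<Longrightarrow> f y \<in> S" and "x \<in> S"
    and trans: "\<And>y z. y \<in> S \<Longrightarrow> z \<in> S \<Longrightarrow> \<exists>k. (f ^^ k) y = z"
  shows "(f ^^ card S) x = x" and "bij_betw (\<lambda>i. (f ^^ i) x) {..<card S} S"
proof -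
  have in_S: "(f ^^ i) x \<in> S" for i
    using assms by (induction i) auto
  obtain k where "(f ^^ k) (f x) = x"
    using trans assms by blast
  then have ex: "\<exists>p>0. (f ^^ p) x = x"
    by (intro exI[of _ "Suc k"]) (simp add: funpow_swap1)
  define p where "p = (LEAST p. p > 0 \<and> (f ^^ p) x = x)"
  have p: "p > 0" "(f ^^ p) x = x"
    using LeastI_ex[OF ex] by (simp_all add: p_def)
  have p_min: "p \<le> q" if "q > 0" "(f ^^ q) x = x" for q
    unfolding p_def using that by (intro Least_le) simp
  have neq: "(f ^^ i) x \<noteq> (f ^^ j) x" if "i < j" "j < p" for i j
  proof
    assume eq: "(f ^^ i) x = (f ^^ j) x"
    \<comment> \<open>Applying \<open>f ^^ (p - j)\<close> to the coincidence yields the return time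
      \<open>p - j + i\<close>, which is positive and smaller than \<open>p\<close>.\<close>
    have "(f ^^ (p - j + i)) x = (f ^^ (p - j)) ((f ^^ j) x)"
      by (simp add: funpow_add eq)
    also have "\<dots> = (f ^^ (p - j + j)) x"
      by (simp only: funpow_add comp_apply)
    also have "\<dots> = x"
      using that p by simp
    finally show False
      using p_min[of "p - j + i"] that by simp
  qed
  have inj: "inj_on (\<lambda>i. (f ^^ i) x) {..<p}"
    by (rule linorder_inj_onI) (use neq in auto)
  have "S \<subseteq> (\<lambda>i. (f ^^ i) x) ` {..<p}"
  proof
    fix y assume "y \<in> S"
    then obtain k where "(f ^^ k) x = y"
      using trans assms by blast
    then have "y = (f ^^ (k mod p)) x"
      using funpow_mod_eq[OF p(2)] by simp
    then show "y \<in> (\<lambda>i. (f ^^ i) x) ` {..<p}"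
      using p by auto
  qed
  then have bij: "bij_betw (\<lambda>i. (f ^^ i) x) {..<p} S"
    using inj in_S by (auto simp: bij_betw_def)
  then have "card S = p"
    using bij_betw_same_card by fastforce
  then show "(f ^^ card S) x = x" and "bij_betw (\<lambda>i. (f ^^ i) x) {..<card S} S"
    using p bij by simp_all
qed

section \<open>Sections of tree endomorphisms\<close>

lemma length_tree_endomorphism: "tree_endomorphism g \<Longrightarrow> length (g w) = length w"
  by (simp add: tree_endomorphism_def)

lemma tree_endomorphism_append:
  "tree_endomorphism g \<Longrightarrow> g (w @ v) = g w @ tree_section g w v"
  using tree_section_iff by blast

lemma tree_endomorphism_id: "tree_endomorphism id"
  by (simp add: tree_endomorphism_def)

lemma tree_endomorphism_comp:
  "tree_endomorphism g \<Longrightarrow> tree_endomorphism h \<Longrightarrow> tree_endomorphism (g \<circ> h)"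
  by (simp add: tree_endomorphism_def)

lemma tree_endomorphism_funpow: "tree_endomorphism g \<Longrightarrow> tree_endomorphism (g ^^ k)"
  by (induction k) (simp_all add: tree_endomorphism_id tree_endomorphism_comp del: id_apply)

lemma tree_automorphism_inj: "tree_automorphism g \<Longrightarrow> inj g"
  unfolding tree_automorphism_def by (metis inj_on_id inj_on_imageI2)

lemma tree_section_Nil: "tree_section g [] = g"
  by (simp add: fun_eq_iff tree_section_def)

lemma tree_section_id: "tree_section id w = id"
  by (simp add: fun_eq_iff tree_section_def)

lemma tree_section_append: "tree_section g (w @ v) = tree_section (tree_section g w) v"
  by (simp add: fun_eq_iff tree_section_def add.commute)

lemma tree_section_comp:
  assumes "tree_endomorphism g" "tree_endomorphism h"
  shows "tree_section (g \<circ> h) w = tree_section g (h w) \<circ> tree_section h w"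
  using assms
  by (simp add: fun_eq_iff tree_section_def[of "g \<circ> h"] tree_endomorphism_append
      length_tree_endomorphism)

lemma inj_tree_section:
  assumes "tree_endomorphism g" "inj g"
  shows "inj (tree_section g w)"
proof (rule injI)
  fix u v assume "tree_section g w u = tree_section g w v"
  then have "g (w @ u) = g (w @ v)"
    using assms by (simp add: tree_endomorphism_append)
  then show "u = v"
    using \<open>inj g\<close> by (auto dest: injD)
qed

lemma tree_section_letter:
  assumes "tree_endomorphism g"
  obtains b where "tree_section g w [a] = [b]"
proof -
  have "length (tree_section g w [a]) = 1"
    using assms by (simp add: tree_section_def length_tree_endomorphism)
  then show ?thesis
    using that by (auto simp: length_Suc_conv)
qed

text \<open>Injectivity gives each map two different values on two different letters, so over a
  binary alphabet the value at one letter forces the value at the other.\<close>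

lemma letter_agree_iff:
  fixes \<beta> \<gamma> :: tree_map
  assumes "inj \<beta>" "inj \<gamma>" and "\<And>a. \<exists>b. \<beta> [a] = [b]" "\<And>a. \<exists>b. \<gamma> [a] = [b]"
  shows "\<beta> [a] = \<gamma> [a] \<longleftrightarrow> \<beta> [b] = \<gamma> [b]"
proof (cases "a = b")
  case False
  then have "\<beta> [a] \<noteq> \<beta> [b]" "\<gamma> [a] \<noteq> \<gamma> [b]"
    using assms(1,2) by (auto dest: injD)
  moreover obtain p q r s where "\<beta> [a] = [p]" "\<beta> [b] = [q]" "\<gamma> [a] = [r]" "\<gamma> [b] = [s]"
    using assms(3,4) by meson
  ultimately show ?thesis
    by simp (metis bit_neq_neq_eq)
qed simp

text \<open>This is the chain rule for sections, iterated along the orbit of \<open>w\<close>; later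
  factors are composed on the left. Identity factors are filtered out so that the length of the list
  counts exactly what bounded activity controls.\<close>

lemma tree_section_funpow:
  assumes "tree_endomorphism g"
  shows "tree_section (g ^^ k) w =
    fold (\<circ>) (filter (\<lambda>h. h \<noteq> id) (map (\<lambda>i. tree_section g ((g ^^ i) w)) [0..<k])) id"
proof (induction k)
  case 0
  then show ?case
    using tree_section_id by (simp add: id_def)
next
  case (Suc k)
  have step: "tree_section (g ^^ Suc k) w = tree_section g ((g ^^ k) w) \<circ> tree_section (g ^^ k) w"
    using assms by (simp add: tree_section_comp tree_endomorphism_funpow)
  show ?case
  proof (cases "tree_section g ((g ^^ k) w) = id")
    case True
    then show ?thesis
      unfolding step Suc by (simp only: upt_Suc_append map_append filter_append list.map
          filter.simps simp_thms if_False le0 append_Nil2 id_comp)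
  next
    case False
    then show ?thesis
      unfolding step Suc by (simp only: upt_Suc_append map_append filter_append list.map
          filter.simps simp_thms if_True le0 fold_append fold_simps
          comp_apply[of "fold f hs" for f hs])
  qed
qed

section \<open>Sections of the action of a Mealy automaton\<close>

lemma mealy_run_append:
  "mealy_run M s (u @ v) = mealy_run M s u @ mealy_run M (foldl (transition M) s u) v"
  by (induction u arbitrary: s) simp_all

lemma length_mealy_run: "length (mealy_run M s u) = length u"
  by (induction u arbitrary: s) simp_all

text \<open>The section at \<open>w\<close> is the run of the same machine from the state reached
  after reading \<open>w\<close>, so there are at most as many sections as states.\<close>

lemma finite_sections_mealy_action:
  assumes "finite_initial_mealy M"
  shows "finite (range (tree_section (mealy_action M)))"
proof (rule finite_surj)
  show "finite (states M)"
    using assms by (simp add: finite_initial_mealy_def)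
  have reach: "foldl (transition M) s w \<in> states M" if "s \<in> states M" for s w
    using that assms by (induction w arbitrary: s) (simp_all add: finite_initial_mealy_def)
  show "range (tree_section (mealy_action M)) \<subseteq> mealy_run M ` states M"
  proof clarify
    fix w
    have "tree_section (mealy_action M) w = mealy_run M (foldl (transition M) (initial M) w)"
      by (simp add: fun_eq_iff tree_section_def mealy_action_def mealy_run_append length_mealy_run)
    then show "tree_section (mealy_action M) w \<in> mealy_run M ` states M"
      using reach assms by (simp add: finite_initial_mealy_def)
  qed
qed

section \<open>Orbits and displacements of a level-transitive map\<close>

locale transitive_tree_map =
  fixes A :: tree_map
  assumes endo: "tree_endomorphism A"
    and transitive: "level_transitive A"
begin

lemma orbit:
  shows funpow_period: "(A ^^ (2 ^ length w)) w = w"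
    and funpow_bij: "bij_betw (\<lambda>i. (A ^^ i) w) {..<2 ^ length w} {v. length v = length w}"
  using single_orbit[of "{v. length v = length w}" A w] endo transitive
  by (simp_all add: card_words length_tree_endomorphism level_transitive_def)

text \<open>Uniqueness holds because the iterates of \<open>w\<close> below the level size are
  distinct. Displacements are thereby computed by exhibiting a candidate.\<close>

lemma disp_eqI: "d < 2 ^ length w \<Longrightarrow> (A ^^ d) w = B w \<Longrightarrow> disp A B w = d"
  unfolding disp_def
  by (rule the_equality) (use funpow_bij[of w] in \<open>auto simp: bij_betw_def inj_on_def\<close>)

lemma disp:
  assumes "tree_endomorphism B"
  shows "disp A B w < 2 ^ length w" and "(A ^^ disp A B w) w = B w"
proof -
  have "B w \<in> (\<lambda>i. (A ^^ i) w) ` {..<2 ^ length w}"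
    using funpow_bij[of w] assms by (simp add: bij_betw_def length_tree_endomorphism)
  then obtain d where "d < 2 ^ length w" "(A ^^ d) w = B w"
    by auto
  with disp_eqI[of d w B] show "disp A B w < 2 ^ length w" "(A ^^ disp A B w) w = B w"
    by auto
qed

text \<open>With \<open>n = length w\<close>, the power \<open>A ^^ (2 ^ n)\<close> fixes
  \<open>w\<close>, but the orbit of \<open>w @ [a]\<close> has length \<open>2 ^ (n + 1)\<close>,
  so the last letter must change.\<close>

lemma section_period_moves_letter: "tree_section (A ^^ (2 ^ length w)) w [a] \<noteq> [a]"
proof
  assume "tree_section (A ^^ (2 ^ length w)) w [a] = [a]"
  then have "(A ^^ (2 ^ length w)) (w @ [a]) = (A ^^ 0) (w @ [a])"
    by (simp add: tree_endomorphism_append tree_endomorphism_funpow endo funpow_period)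
  then show False
    using funpow_bij[of "w @ [a]"]
    by (auto simp: bij_betw_def dest!: inj_onD[where x = "2 ^ length w" and y = 0])
qed

text \<open>The bound on \<open>k\<close> is not strict, so that one finite set contains both the
  second components of the states, with exponents below \<open>2 ^ length w\<close>, and the third
  ones, with exponent \<open>2 ^ length w\<close>.\<close>

lemma finite_orbit_sections:
  assumes "bounded_activity A" and "finite (range (tree_section A))"
  shows "finite {tree_section (A ^^ k) w | k w. k \<le> 2 ^ length w}"
proof -
  obtain c where c: "card {w. length w = n \<and> tree_section A w \<noteq> id} < c" for n
    using assms(1) by (auto simp: bounded_activity_def)
  let ?L = "{hs. set hs \<subseteq> range (tree_section A) \<and> length hs \<le> c}"
  have "{tree_section (A ^^ k) w | k w. k \<le> 2 ^ length w} \<subseteq> (\<lambda>hs. fold (\<circ>) hs id) ` ?L"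
  proof clarify
    fix k :: nat and w :: "bit list"
    assume k: "k \<le> 2 ^ length w"
    let ?hs = "filter (\<lambda>h. h \<noteq> id) (map (\<lambda>i. tree_section A ((A ^^ i) w)) [0..<k])"
    let ?I = "{i. i < k \<and> tree_section A ((A ^^ i) w) \<noteq> id}"
    have "length ?hs = length (filter (\<lambda>i. tree_section A ((A ^^ i) w) \<noteq> id) [0..<k])"
      by (simp add: filter_map comp_def)
    also have "\<dots> = card (set (filter (\<lambda>i. tree_section A ((A ^^ i) w) \<noteq> id) [0..<k]))"
      by (rule distinct_card[symmetric]) simp
    also have "set (filter (\<lambda>i. tree_section A ((A ^^ i) w) \<noteq> id) [0..<k]) = ?I"
      by auto
    also have "card ?I \<le> card {v. length v = length w \<and> tree_section A v \<noteq> id}"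
    \<comment> \<open>As \<open>k\<close> is at most the orbit length, the indices of nontrivial
      factors inject into the active words of that level.\<close>
    proof (rule card_inj_on_le)
      show "inj_on (\<lambda>i. (A ^^ i) w) ?I"
        using funpow_bij[of w] k by (auto simp: bij_betw_def intro: inj_on_subset)
      show "(\<lambda>i. (A ^^ i) w) ` ?I \<subseteq> {v. length v = length w \<and> tree_section A v \<noteq> id}"
        by (auto simp: length_tree_endomorphism tree_endomorphism_funpow endo)
      show "finite {v. length v = length w \<and> tree_section A v \<noteq> id}"
        by (rule finite_subset[OF _ finite_words[of "length w"]]) auto
    qed
    also have "\<dots> \<le> c"
      using c less_imp_le by blast
    finally have "length ?hs \<le> c" .
    then have "?hs \<in> ?L"
      by (auto simp del: id_apply)
    then show "tree_section (A ^^ k) w \<in> (\<lambda>hs. fold (\<circ>) hs id) ` ?L"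
      unfolding tree_section_funpow[OF endo] by (rule imageI)
  qed
  then show ?thesis
    using finite_lists_length_le[OF assms(2)] by (rule finite_surj[rotated])
qed

section \<open>States and transitions, indexed by words\<close>

definition L_state :: "tree_map \<Rightarrow> bit list \<Rightarrow> tree_map \<times> tree_map \<times> tree_map" where
  "L_state B w = (tree_section B w, tree_section (A ^^ disp A B w) w,
     tree_section (A ^^ (2 ^ length w)) w)"

lemma states_L_automaton: "states (L_automaton A B) = range (L_state B)"
  by (auto simp: L_automaton_def L_state_def)

lemma L_state_Nil: "L_state B [] = (B, id, A)" if "tree_endomorphism B"
proof -
  \<comment> \<open>The only exponent below \<open>2 ^ 0 = 1\<close> is 0.\<close>
  have "disp A B [] = 0"
    using disp(1)[OF that, of "[]"] by simp
  then show ?thesis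
    unfolding L_state_def by (simp add: tree_section_Nil tree_section_id del: id_apply)
qed

lemma section_letter_agree_iff:
  assumes "inj A" "tree_endomorphism B" "inj B"
  shows "tree_section B w [a] = tree_section (A ^^ k) w [a] \<longleftrightarrow>
    tree_section B w [b] = tree_section (A ^^ k) w [b]"
proof (rule letter_agree_iff)
  show "inj (tree_section B w)" "inj (tree_section (A ^^ k) w)"
    using assms endo by (simp_all add: inj_tree_section tree_endomorphism_funpow inj_fn)
  show "\<exists>b. tree_section B w [a] = [b]" "\<exists>b. tree_section (A ^^ k) w [a] = [b]" for a
    using assms endo by (meson tree_section_letter tree_endomorphism_funpow)+
qed

text \<open>This yields closure of the state set under transitions. Modulo
  \<open>2 ^ length w\<close>, the displacement of \<open>w @ [a]\<close> is that of
  \<open>w\<close>, so it is \<open>d\<close> or \<open>d + 2 ^ length w\<close>; comparing \<beta>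
  and \<gamma> at \<open>a\<close> decides which.\<close>

lemma transition_L_state:
  assumes "inj A" "tree_endomorphism B" "inj B"
  shows "transition (L_automaton A B) (L_state B w) a = L_state B (w @ [a])"
proof -
  define d where "d = disp A B w"
  let ?\<beta> = "tree_section B w"
  let ?\<gamma> = "tree_section (A ^^ d) w"
  let ?\<delta> = "tree_section (A ^^ (2 ^ length w)) w"
  have pow: "tree_endomorphism (A ^^ k)" for k
    using endo by (rule tree_endomorphism_funpow)
  have d: "d < 2 ^ length w" "(A ^^ d) w = B w"
    using disp[OF assms(2)] by (simp_all add: d_def)
  \<comment> \<open>Because \<open>A ^^ (2 ^ length w)\<close> fixes \<open>w\<close>, the section
    of its square at \<open>w\<close> is the square of its section.\<close>
  have \<delta>2: "tree_section (A ^^ (2 ^ length (w @ [a]))) (w @ [a]) = tree_section (?\<delta> ^^ 2) [a]"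
  proof -
    have "A ^^ (2 ^ length (w @ [a])) = A ^^ (2 ^ length w) \<circ> A ^^ (2 ^ length w)"
      by (simp add: mult_2 funpow_add)
    moreover have "?\<delta> ^^ 2 = ?\<delta> \<circ> ?\<delta>"
      by (simp add: numeral_2_eq_2)
    ultimately show ?thesis
      by (simp add: tree_section_append tree_section_comp pow funpow_period)
  qed
  have "tree_section (A ^^ disp A B (w @ [a])) (w @ [a]) =
    (if ?\<beta> [a] = ?\<gamma> [a] then tree_section ?\<gamma> [a] else tree_section (?\<gamma> \<circ> ?\<delta>) [a])"
  proof (cases "?\<beta> [a] = ?\<gamma> [a]")
    case True
    then have "disp A B (w @ [a]) = d"
      using d by (intro disp_eqI) (simp_all add: tree_endomorphism_append pow assms)
    then show ?thesis
      using True by (simp add: tree_section_append)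
  next
    case False
    obtain b where b: "?\<delta> [a] = [b]"
      by (rule tree_section_letter[OF pow])
    then have "b \<noteq> a"
      using section_period_moves_letter[of w a] by auto
    moreover have "inj ?\<gamma>"
      using assms pow by (simp add: inj_tree_section inj_fn)
    ultimately have "?\<gamma> [b] \<noteq> ?\<gamma> [a]"
      by (auto dest: injD)
    moreover obtain p where "?\<gamma> [a] = [p]"
      by (rule tree_section_letter[OF pow])
    moreover obtain q where "?\<gamma> [b] = [q]"
      by (rule tree_section_letter[OF pow])
    moreover obtain r where "?\<beta> [a] = [r]"
      by (rule tree_section_letter[OF assms(2)])
    \<comment> \<open>Both \<open>?\<gamma> [b]\<close> and \<open>?\<beta> [a]\<close> differ from
      \<open>?\<gamma> [a]\<close>, so they coincide.\<close>
    ultimately have "?\<gamma> (?\<delta> [a]) = ?\<beta> [a]"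
      using False b by simp (metis bit_neq_neq_eq)
    \<comment> \<open>The additional full period leaves \<open>w\<close> in place and applies
      \<delta> to the letter before \<gamma> acts.\<close>
    then have "(A ^^ (d + 2 ^ length w)) (w @ [a]) = B (w @ [a])"
      using d by (simp add: funpow_add tree_endomorphism_append pow assms funpow_period)
    then have "disp A B (w @ [a]) = d + 2 ^ length w"
      using d by (intro disp_eqI) simp_all
    then show ?thesis
      using False
      by (simp add: tree_section_append funpow_add tree_section_comp pow funpow_period)
  qed
  then show ?thesis
    unfolding L_state_def \<delta>2 by (simp add: L_automaton_def tree_section_append d_def)
qed

end

theorem proposition6p4:
  fixes A B :: "bit list \<Rightarrow> bit list"
    and M :: "('s, bit) mealy" and N :: "('t, bit) mealy"
  assumes "tree_automorphism A"
    and "finite_initial_mealy M" and "A = mealy_action M"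
    and "bounded_activity A"
    and "level_transitive A"
    and "tree_automorphism B"
    and "finite_initial_mealy N" and "B = mealy_action N"
  shows "moore_machine (L_automaton A B)"
proof -
  have B: "tree_endomorphism B" "inj B" and "inj A"
    using assms(1,6) tree_automorphism_inj by (auto simp: tree_automorphism_def)
  interpret transitive_tree_map A
    using assms(1,5) by unfold_locales (simp_all add: tree_automorphism_def)
  let ?P = "{tree_section (A ^^ k) w | k w. k \<le> 2 ^ length w}"
  have "range (L_state B) \<subseteq> range (tree_section B) \<times> ?P \<times> ?P"
    using less_imp_le[OF disp(1)[OF B(1)]] unfolding L_state_def by blast
  moreover have "finite (range (tree_section B))" "finite (range (tree_section A))"
    using finite_sections_mealy_action assms by blast+
  ultimately have "finite (states (L_automaton A B))"
    unfolding states_L_automaton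
    using finite_orbit_sections[OF assms(4)] by (meson finite_SigmaI finite_subset)
  moreover have "initial (L_automaton A B) = L_state B []"
    unfolding L_state_Nil[OF B(1)] by (simp add: L_automaton_def)
  moreover have "out_letter (L_automaton A B) s x = out_letter (L_automaton A B) s y"
    if "s \<in> states (L_automaton A B)" for s x y
    \<comment> \<open>A state belongs to some word \<open>w\<close>, so its first two components are
      sections at \<open>w\<close> of \<open>B\<close> and of a power of \<open>A\<close>; whether
      they agree at a letter is independent of that letter.\<close>
    using that section_letter_agree_iff[OF \<open>inj A\<close> B, of _ x _ y]
    unfolding states_L_automaton by (auto simp: L_state_def L_automaton_def)
  ultimately show ?thesis
    unfolding moore_machine_def finite_initial_mealy_def
    using transition_L_state[OF \<open>inj A\<close> B] by (auto simp: states_L_automaton)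
qed

end
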